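(* There exists $n_0$ such that for every $n>n_0$ there is an odd-sunflower-free family $\mathcal{F}\subseteq 2^{\{1,\dots,n\}}$ with $|\mathcal{F}|>1.502148^n$. That is, $f_{odd}(n)>1.502148^n$ for all $n>n_0$, where $f_{odd}(n)$ is the maximum size of an odd-sunflower-free family of subsets of $\{1,\dots,n\}$.
   Context: A family of at least two nonempty sets is an odd-sunflower if every element of the underlying set is contained in an odd number of sets of the family, or in none. A family is odd-sunflower-free if no subfamily of it is an odd-sunflower. *)

theory Defs
  imports Complex_Main
begin

text \<open>No ground set is passed: an element outside it lies in no member of the family, which the
  last conjunct permits. The condition \<open>card F \<ge> 2\<close> makes \<open>F\<close> finite, as is every family of
  subsets of \<open>{1..n}\<close>.\<close>

definition odd_sunflower :: "'a set set \<Rightarrow> bool" where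
  "odd_sunflower F \<longleftrightarrow>
     card F \<ge> 2 \<and> (\<forall>A\<in>F. A \<noteq> {}) \<and>
     (\<forall>x. odd (card {A\<in>F. x \<in> A}) \<or> {A\<in>F. x \<in> A} = {})"

definition odd_sunflower_free :: "'a set set \<Rightarrow> bool" where
  "odd_sunflower_free F \<longleftrightarrow> (\<forall>G\<subseteq>F. \<not> odd_sunflower G)"

definition f_odd :: "nat \<Rightarrow> nat" where
  "f_odd n = Max {card F | F. F \<subseteq> Pow {1..n} \<and> odd_sunflower_free F}"

lemma f_odd_candidates:
  "finite {card F | F. F \<subseteq> Pow {1..n::nat} \<and> odd_sunflower_free F}"
  "{card F | F. F \<subseteq> Pow {1..n::nat} \<and> odd_sunflower_free F} \<noteq> {}"
proof -
  have "{card F | F. F \<subseteq> Pow {1..n} \<and> odd_sunflower_free F} \<subseteq> card ` Pow (Pow {1..n})"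
    by auto
  then show "finite {card F | F. F \<subseteq> Pow {1..n} \<and> odd_sunflower_free F}"
    by (rule finite_subset) simp
  have "odd_sunflower_free ({} :: nat set set)"
    by (simp add: odd_sunflower_free_def odd_sunflower_def)
  then show "{card F | F. F \<subseteq> Pow {1..n} \<and> odd_sunflower_free F} \<noteq> {}"
    by blast
qed

end

theory Submission
  imports Defs "HOL-Library.FuncSet"
begin

text \<open>
  Split \<open>m \<cdot> 8 \<cdot> 3\<close> points into \<open>m\<close> groups of \<open>8\<close> triples and add one further point that lies in
  every set. A set of the family omits exactly one triple of each group and exactly one point of
  every other triple, so there are \<open>(8 \<cdot> 3\<^sup>7)\<^sup>m\<close> sets on \<open>24 m + 1\<close> points, and
  \<open>17496 > 1.502148\<^sup>2\<^sup>4\<close>.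

  Suppose that every point has odd or zero degree in a nonempty subfamily \<open>G\<close>. The common point
  makes \<open>|G|\<close> odd. If the members of a family of size \<open>N\<close> each omit one of \<open>k\<close> items and every
  item is used an odd number of times, then each item is omitted \<open>\<equiv> N - 1\<close> times modulo \<open>2\<close>,
  whence \<open>N \<equiv> k (N - 1)\<close>, which is impossible if \<open>N\<close> or \<open>k\<close> is odd. Hence some item is never
  used, that is, all members omit the same one. Applied to the points of a triple (\<open>k\<close> odd) and
  then to the triples of a group (\<open>N = |G|\<close> odd), this shows that \<open>G\<close> has only one member.
\<close>

section \<open>Parity of omission counts\<close>

lemma omitted_item_constant:
  fixes t :: "'a \<Rightarrow> 'b"
  assumes "finite G" "finite J" and t: "t ` G \<subseteq> J"
    and deg: "\<And>j. j \<in> J \<Longrightarrow> odd (card {w\<in>G. t w \<noteq> j}) \<or> {w\<in>G. t w \<noteq> j} = {}"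
    and par: "odd (card G) \<or> odd (card J)"
  shows "\<exists>j. \<forall>w\<in>G. t w = j"
proof (rule ccontr)
  assume nconst: "\<nexists>j. \<forall>w\<in>G. t w = j"
  have odd_used: "odd (card {w\<in>G. t w \<noteq> j})" if "j \<in> J" for j
    using deg[OF that] nconst by blast
  have split: "card G = card {w\<in>G. t w = j} + card {w\<in>G. t w \<noteq> j}" for j
    using \<open>finite G\<close>
    by (subst card_Un_disjoint[symmetric]) (auto intro!: arg_cong[of _ _ card])
  have omitted: "even (card {w\<in>G. t w = j}) \<longleftrightarrow> odd (card G)" if "j \<in> J" for j
    using split[of j] odd_used[OF that] by simp
  have total: "card G = (\<Sum>j\<in>J. card {w\<in>G. t w = j})"
    using sum.group[OF \<open>finite G\<close> \<open>finite J\<close> t, of "\<lambda>_. 1::nat"] by simp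
  \<comment> \<open>The parity of the sum \<open>total\<close> is that of the number of its odd
    terms.\<close>
  have "{j\<in>J. odd (card {w\<in>G. t w = j})} = (if odd (card G) then {} else J)"
    using omitted by auto
  then have "even (card G) \<longleftrightarrow> even (card (if odd (card G) then {} else J))"
    using total even_sum_iff[OF \<open>finite J\<close>, of "\<lambda>j. card {w\<in>G. t w = j}"] by simp
  then show False
    using par by (auto split: if_splits)
qed

section \<open>Words and the sets they encode\<close>

definition omission_words :: "nat \<Rightarrow> nat \<Rightarrow> (nat \<times> (nat \<Rightarrow> nat)) set" where
  "omission_words k q = (SIGMA i:{..<k}. ({..<k} - {i}) \<rightarrow>\<^sub>E {..<q})"

text \<open>\<open>w c = (i, g)\<close>: in group \<open>c\<close> the block \<open>i\<close> is omitted, and \<open>g j\<close> is the point omitted in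
  block \<open>j \<noteq> i\<close>. \<open>None\<close> is the common point.\<close>

definition word_set ::
  "nat \<Rightarrow> nat \<Rightarrow> nat \<Rightarrow> (nat \<Rightarrow> nat \<times> (nat \<Rightarrow> nat)) \<Rightarrow> (nat \<times> nat \<times> nat) option set" where
  "word_set k q m w = insert None
     (Some ` {(c, j, p). c < m \<and> j < k \<and> j \<noteq> fst (w c) \<and> p < q \<and> p \<noteq> snd (w c) j})"

lemma Some_in_word_set [simp]:
  "Some (c, j, p) \<in> word_set k q m w \<longleftrightarrow>
     c < m \<and> j < k \<and> j \<noteq> fst (w c) \<and> p < q \<and> p \<noteq> snd (w c) j"
  by (auto simp: word_set_def)

lemma word_set_subset:
  "word_set k q m w \<subseteq> insert None (Some ` ({..<m} \<times> {..<k} \<times> {..<q}))"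
  by (auto simp: word_set_def)

lemma card_omission_words: "card (omission_words k q) = k * q ^ (k - 1)"
  by (simp add: omission_words_def card_PiE finite_PiE)

lemma omission_wordsD:
  assumes "u \<in> omission_words k q"
  shows "fst u < k" "snd u \<in> ({..<k} - {fst u}) \<rightarrow>\<^sub>E {..<q}"
  using assms unfolding omission_words_def by (cases u; simp)+

lemma words_eqI:
  assumes "w \<in> {..<m} \<rightarrow>\<^sub>E omission_words k q" "w' \<in> {..<m} \<rightarrow>\<^sub>E omission_words k q"
    and "\<And>c. c < m \<Longrightarrow> fst (w c) = fst (w' c)"
    and "\<And>c j. c < m \<Longrightarrow> j < k \<Longrightarrow> j \<noteq> fst (w c) \<Longrightarrow> snd (w c) j = snd (w' c) j"
  shows "w = w'"
proof (rule PiE_ext[OF assms(1,2)])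
  fix c assume "c \<in> {..<m}"
  then have c: "c < m" by simp
  have "w c \<in> omission_words k q" "w' c \<in> omission_words k q"
    using assms(1,2) c by auto
  then have "snd (w c) \<in> ({..<k} - {fst (w c)}) \<rightarrow>\<^sub>E {..<q}"
    "snd (w' c) \<in> ({..<k} - {fst (w c)}) \<rightarrow>\<^sub>E {..<q}"
    using omission_wordsD(2) assms(3)[OF c] by metis+
  then have "snd (w c) = snd (w' c)"
    by (rule PiE_ext) (use assms(4)[OF c] in auto)
  with assms(3)[OF c] show "w c = w' c"
    by (simp add: prod_eq_iff)
qed

lemma word_bounds:
  assumes "w \<in> {..<m} \<rightarrow>\<^sub>E omission_words k q" "c < m"
  shows "fst (w c) < k" "j < k \<Longrightarrow> j \<noteq> fst (w c) \<Longrightarrow> snd (w c) j < q"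
proof -
  have "w c \<in> omission_words k q"
    using assms by auto
  from omission_wordsD[OF this]
  show "fst (w c) < k" "j < k \<Longrightarrow> j \<noteq> fst (w c) \<Longrightarrow> snd (w c) j < q"
    by (auto simp: PiE_iff)
qed

lemma ex_other_point:
  assumes "2 \<le> (q::nat)"
  shows "\<exists>p<q. p \<noteq> a"
  using assms by (intro exI[of _ "if a = 0 then 1 else 0"]) auto

text \<open>As \<open>q\<close> is at least 2, every kept block retains a point, so the omitted
  block of a group is its only empty one. In a kept block the missing point is then visible.\<close>

lemma inj_on_word_set:
  assumes "2 \<le> q"
  shows "inj_on (word_set k q m) ({..<m} \<rightarrow>\<^sub>E omission_words k q)"
proof (rule inj_onI)
  fix w w'
  assume w: "w \<in> {..<m} \<rightarrow>\<^sub>E omission_words k q" "w' \<in> {..<m} \<rightarrow>\<^sub>E omission_words k q"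
    and eq: "word_set k q m w = word_set k q m w'"
  have pt: "j \<noteq> fst (w c) \<and> p \<noteq> snd (w c) j \<longleftrightarrow> j \<noteq> fst (w' c) \<and> p \<noteq> snd (w' c) j"
    if "c < m" "j < k" "p < q" for c j p
    using arg_cong[OF eq, of "\<lambda>S. Some (c, j, p) \<in> S"] that by simp
  have fst_eq: "fst (w c) = fst (w' c)" if c: "c < m" for c
  proof -
    obtain p where "p < q" "p \<noteq> snd (w' c) (fst (w c))"
      using ex_other_point[OF assms] by blast
    then show ?thesis
      using pt[OF c word_bounds(1)[OF w(1) c], of p] by auto
  qed
  show "w = w'"
  proof (rule words_eqI[OF w fst_eq])
    fix c j assume "c < m" "j < k" "j \<noteq> fst (w c)"
    then show "snd (w c) j = snd (w' c) j"
      using pt[of c j "snd (w c) j"] word_bounds(2)[OF w(1)] fst_eq by auto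
  qed
qed

lemma odd_degrees_imp_single_word:
  assumes q: "odd q" "2 \<le> q"
    and "finite G" "G \<subseteq> {..<m} \<rightarrow>\<^sub>E omission_words k q"
    and deg: "\<And>x. odd (card {w\<in>G. x \<in> word_set k q m w}) \<or> {w\<in>G. x \<in> word_set k q m w} = {}"
    and w: "w \<in> G" "w' \<in> G"
  shows "w = w'"
proof -
  have "{w\<in>G. None \<in> word_set k q m w} = G"
    by (auto simp: word_set_def)
  with deg[of None] w have odd_G: "odd (card G)"
    by auto
  have words: "v \<in> {..<m} \<rightarrow>\<^sub>E omission_words k q" if "v \<in> G" for v
    using that assms(4) by blast
  have block_deg: "odd (card {v\<in>G. fst (v c) \<noteq> j \<and> snd (v c) j \<noteq> p}) \<or>
      {v\<in>G. fst (v c) \<noteq> j \<and> snd (v c) j \<noteq> p} = {}" if "c < m" "j < k" "p < q" for c j p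
  proof -
    have "{v\<in>G. fst (v c) \<noteq> j \<and> snd (v c) j \<noteq> p} = {v\<in>G. Some (c, j, p) \<in> word_set k q m v}"
      using that by auto
    then show ?thesis
      using deg[of "Some (c, j, p)"] by simp
  qed
  \<comment> \<open>The number of members keeping block \<open>j\<close> may be even; here the
    parity argument rests on \<open>q\<close> being odd.\<close>
  have block: "\<exists>a. \<forall>v\<in>G. fst (v c) \<noteq> j \<longrightarrow> snd (v c) j = a" if c: "c < m" and j: "j < k" for c j
  proof -
    have "\<exists>a. \<forall>v\<in>{v\<in>G. fst (v c) \<noteq> j}. snd (v c) j = a"
    proof (rule omitted_item_constant)
      show "(\<lambda>v. snd (v c) j) ` {v\<in>G. fst (v c) \<noteq> j} \<subseteq> {..<q}"
        using word_bounds(2)[OF words c j] by auto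
      show "odd (card {v \<in> {v\<in>G. fst (v c) \<noteq> j}. snd (v c) j \<noteq> p}) \<or>
          {v \<in> {v\<in>G. fst (v c) \<noteq> j}. snd (v c) j \<noteq> p} = {}" if "p \<in> {..<q}" for p
        using block_deg[OF c j, of p] that by simp
    qed (use q \<open>finite G\<close> in auto)
    then show ?thesis by blast
  qed
  \<comment> \<open>Now \<open>k\<close> may be even, and \<open>odd_G\<close> supplies the
    parity.\<close>
  have group: "\<exists>i. \<forall>v\<in>G. fst (v c) = i" if c: "c < m" for c
  proof (rule omitted_item_constant[where J = "{..<k}"])
    show "(\<lambda>v. fst (v c)) ` G \<subseteq> {..<k}"
      using word_bounds(1)[OF words c] by auto
    fix j assume "j \<in> {..<k}"
    then have j: "j < k" by simp
    obtain a where a: "\<forall>v\<in>G. fst (v c) \<noteq> j \<longrightarrow> snd (v c) j = a"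
      using block[OF c j] by blast
    \<comment> \<open>Since \<open>a\<close> is the only point omitted from a kept block
      \<open>j\<close>, the degree of \<open>p\<close> counts exactly the members that keep the
      block.\<close>
    obtain p where p: "p < q" "p \<noteq> a"
      using ex_other_point[OF q(2)] by blast
    have "{v\<in>G. fst (v c) \<noteq> j \<and> snd (v c) j \<noteq> p} = {v\<in>G. fst (v c) \<noteq> j}"
      using a p(2) by blast
    then show "odd (card {v\<in>G. fst (v c) \<noteq> j}) \<or> {v\<in>G. fst (v c) \<noteq> j} = {}"
      using block_deg[OF c j p(1)] by (simp only:)
  qed (use odd_G \<open>finite G\<close> in auto)
  show ?thesis
  proof (rule words_eqI[OF words[OF w(1)] words[OF w(2)]])
    show fst_eq: "fst (w c) = fst (w' c)" if "c < m" for c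
      using group[OF that] w by auto
    show "snd (w c) j = snd (w' c) j" if "c < m" "j < k" "j \<noteq> fst (w c)" for c j
    proof -
      obtain a where "\<forall>v\<in>G. fst (v c) \<noteq> j \<longrightarrow> snd (v c) j = a"
        using block[OF \<open>c < m\<close> \<open>j < k\<close>] by blast
      then show ?thesis
        using w fst_eq[OF \<open>c < m\<close>] \<open>j \<noteq> fst (w c)\<close> by simp
    qed
  qed
qed

section \<open>From words to families of subsets of \<open>{1..n}\<close>\<close>

text \<open>Injectivity carries degrees over from sets to indices, and an odd-sunflower has two
  distinct members.\<close>

lemma odd_sunflower_free_indexedI:
  assumes inj: "inj_on A W"
    and single: "\<And>G w w'. finite G \<Longrightarrow> G \<subseteq> W \<Longrightarrow>
      (\<And>x. odd (card {w\<in>G. x \<in> A w}) \<or> {w\<in>G. x \<in> A w} = {}) \<Longrightarrow> w \<in> G \<Longrightarrow> w' \<in> G \<Longrightarrow> w = w'"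
  shows "odd_sunflower_free (A ` W)"
  unfolding odd_sunflower_free_def
proof (intro allI impI notI)
  fix H assume "H \<subseteq> A ` W" and H: "odd_sunflower H"
  then obtain G where G: "G \<subseteq> W" "H = A ` G"
    by (meson subset_imageE)
  have inj_G: "inj_on A G"
    using inj G(1) by (rule inj_on_subset)
  have card_G: "card G \<ge> 2"
    using H by (simp add: odd_sunflower_def G(2) card_image[OF inj_G])
  then have "finite G"
    by (intro card_ge_0_finite) simp
  have "odd (card {w\<in>G. x \<in> A w}) \<or> {w\<in>G. x \<in> A w} = {}" for x
  proof -
    have img: "{B\<in>H. x \<in> B} = A ` {w\<in>G. x \<in> A w}"
      unfolding G(2) by blast
    have "inj_on A {w\<in>G. x \<in> A w}"
      by (rule inj_on_subset[OF inj_G]) auto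
    then have "card {B\<in>H. x \<in> B} = card {w\<in>G. x \<in> A w}"
      by (simp add: img card_image)
    moreover have "odd (card {B\<in>H. x \<in> B}) \<or> {B\<in>H. x \<in> B} = {}"
      using H unfolding odd_sunflower_def by blast
    ultimately show ?thesis
      unfolding img image_is_empty by (simp only:)
  qed
  then have "\<forall>w\<in>G. \<forall>w'\<in>G. w = w'"
    by (intro ballI single[OF \<open>finite G\<close> G(1)])
  then have "card G \<le> 1"
    by (simp only: card_le_Suc0_iff_eq[OF \<open>finite G\<close>] One_nat_def)
  with card_G show False by simp
qed

lemma odd_sunflower_free_family_exists:
  assumes q: "odd q" "2 \<le> q" and n: "m * k * q + 1 \<le> n"
  shows "\<exists>F. F \<subseteq> Pow {1..n} \<and> odd_sunflower_free F \<and> card F = (k * q ^ (k - 1)) ^ m"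
proof -
  define X :: "(nat \<times> nat \<times> nat) option set"
    where "X = insert None (Some ` ({..<m} \<times> {..<k} \<times> {..<q}))"
  define W where "W = {..<m} \<rightarrow>\<^sub>E omission_words k q"
  have "card X = m * k * q + 1" "finite X"
    by (simp_all add: X_def card_insert_if card_image card_cartesian_product)
  then obtain f where f: "f ` X \<subseteq> {1..n}" "inj_on f X"
    using card_le_inj[of X "{1..n}"] n by auto
  define A where "A w = f ` word_set k q m w" for w
  have sub: "word_set k q m w \<subseteq> X" for w
    unfolding X_def by (rule word_set_subset)
  have mem: "f x \<in> A w \<longleftrightarrow> x \<in> word_set k q m w" if "x \<in> X" for x w
    unfolding A_def using inj_on_image_mem_iff[OF f(2) that sub] .
  have inj: "inj_on A W"
  proof (rule inj_onI)
    fix w w' assume "w \<in> W" "w' \<in> W" "A w = A w'"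
    then show "w = w'"
      using inj_onD[OF inj_on_word_set[OF q(2)]] inj_on_image_eq_iff[OF f(2) sub sub]
      unfolding A_def W_def by metis
  qed
  have "odd_sunflower_free (A ` W)"
  proof (rule odd_sunflower_free_indexedI[OF inj])
    fix G w w'
    assume G: "finite G" "G \<subseteq> W"
      and deg: "\<And>x. odd (card {w\<in>G. x \<in> A w}) \<or> {w\<in>G. x \<in> A w} = {}"
      and w: "w \<in> G" "w' \<in> G"
    have "odd (card {w\<in>G. x \<in> word_set k q m w}) \<or> {w\<in>G. x \<in> word_set k q m w} = {}" for x
    proof (cases "x \<in> X")
      case True
      then show ?thesis using deg[of "f x"] by (simp only: mem)
    next
      case False
      then show ?thesis using sub by blast
    qed
    then show "w = w'"
      by (rule odd_degrees_imp_single_word[OF q G(1) G(2)[unfolded W_def] _ w])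
  qed
  moreover have "A ` W \<subseteq> Pow {1..n}"
    using f(1) sub unfolding A_def by blast
  moreover have "card (A ` W) = (k * q ^ (k - 1)) ^ m"
    unfolding card_image[OF inj] by (simp add: W_def card_PiE card_omission_words)
  ultimately show ?thesis by blast
qed

section \<open>Growth rate\<close>

text \<open>Rounding the exponent down costs at most a factor \<open>b ^ d\<close>, which a large
  enough power of the ratio \<open>c / b ^ d > 1\<close> outweighs. The \<open>n - 1\<close> leaves
  room for the common point.\<close>

lemma power_div_eventually_greater:
  fixes b c :: real and d :: nat
  assumes "1 < b" "b ^ d < c" "0 < d"
  shows "\<exists>n0. \<forall>n>n0. b ^ n < c ^ ((n - 1) div d)"
proof -
  have b_pos: "0 < b ^ e" for e
    using assms(1) by simp
  have ratio: "1 < c / b ^ d"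
    using assms(2) b_pos by simp
  then obtain M where M: "b ^ d < (c / b ^ d) ^ M"
    using real_arch_pow by blast
  have "b ^ n < c ^ ((n - 1) div d)" if "n > M * d" for n
  proof -
    define m where "m = (n - 1) div d"
    have "M \<le> m"
      using that \<open>0 < d\<close> by (simp add: m_def less_eq_div_iff_mult_less_eq)
    have "n - 1 < d * m + d"
      using mult_div_mod_eq[of d "n - 1"] mod_less_divisor[OF \<open>0 < d\<close>, of "n - 1"]
      unfolding m_def by linarith
    then have "b ^ n \<le> b ^ (d * m + d)"
      using assms(1) by (intro power_increasing) auto
    also have "\<dots> = (b ^ d) ^ m * b ^ d"
      by (simp add: power_add power_mult)
    also have "\<dots> < (b ^ d) ^ m * (c / b ^ d) ^ M"
      using M assms(1) by (intro mult_strict_left_mono) auto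
    also have "\<dots> \<le> (b ^ d) ^ m * (c / b ^ d) ^ m"
      using ratio \<open>M \<le> m\<close> assms(1) by (intro mult_left_mono power_increasing) auto
    also have "\<dots> = c ^ m"
      using assms(1) by (simp add: power_divide)
    finally show ?thesis
      by (simp add: m_def)
  qed
  then show ?thesis by blast
qed

theorem theorem2:
  shows "\<exists>n0::nat. \<forall>n>n0.
    (\<exists>F. F \<subseteq> Pow {1..n} \<and> odd_sunflower_free F \<and> real (card F) > (1.502148::real) ^ n) \<and>
    real (f_odd n) > (1.502148::real) ^ n"
proof -
  \<comment> \<open>For \<open>q = 3\<close> the growth per point,
    \<open>(k * 3 ^ (k - 1)) powr (1 / (3 * k))\<close>, is largest at the integer
    \<open>k = 8\<close>.\<close>
  have "(1.502148::real) ^ 24 < 17496"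
    by (simp add: divide_simps)
  then obtain n0 where n0: "\<forall>n>n0. (1.502148::real) ^ n < 17496 ^ ((n - 1) div 24)"
    using power_div_eventually_greater[of "1.502148" 24 17496] by auto
  show ?thesis
  proof (intro exI[of _ n0] allI impI)
    fix n assume "n > n0"
    define m where "m = (n - 1) div 24"
    \<comment> \<open>From \<open>n > n0\<close> follows \<open>n \<ge> 1\<close>, so the
      subtraction in \<open>m\<close> does not truncate.\<close>
    have "m * 8 * 3 + 1 \<le> n"
      using \<open>n > n0\<close> by (simp add: m_def)
    then obtain F where F: "F \<subseteq> Pow {1..n}" "odd_sunflower_free F" "card F = 17496 ^ m"
      using odd_sunflower_free_family_exists[of 3 m 8 n] by auto
    have large: "real (card F) > 1.502148 ^ n"
      using n0 \<open>n > n0\<close> F(3) by (simp add: m_def)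
    have "card F \<le> f_odd n"
      unfolding f_odd_def by (rule Max_ge[OF f_odd_candidates(1)]) (use F in blast)
    with F large show "(\<exists>F. F \<subseteq> Pow {1..n} \<and> odd_sunflower_free F \<and>
        real (card F) > (1.502148::real) ^ n) \<and> real (f_odd n) > (1.502148::real) ^ n"
      by (intro conjI exI[of _ F]) linarith+
  qed
qed

end
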